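(* There exists no finite Nmatrix which characterizes $\mathbf{bI}$; that is, there is no Nmatrix $\mathcal M=(\mathcal A,D)$ over $\Sigma_{\mathbf{bI}}$ with finite universe such that, for every set of formulas $\Gamma\cup\{\varphi\}\subseteq\mathbf F(\Sigma_{\mathbf{bI}},\mathcal V)$, $\Gamma\vdash_{\mathbf{bI}}\varphi$ if and only if $\Gamma\vDash_{\mathcal M}\varphi$.
   Context: Let $\mathcal V$ be a countably infinite set of propositional variables and $\Sigma_{\mathbf{bI}}=\{\vee,\wedge,\rightarrow,\uparrow\}$, all connectives binary; $\mathbf F(\Sigma_{\mathbf{bI}},\mathcal V)$ is the set of formulas. The logic $\mathbf{bI}$ is the Hilbert calculus whose only inference rule is Modus Ponens and whose axioms are all instances (with arbitrary formulas) of: (1) $\alpha\to(\beta\to\alpha)$; (2) $(\alpha\to(\beta\to\gamma))\to((\alpha\to\beta)\to(\alpha\to\gamma))$; (3) $\alpha\to(\beta\to(\alpha\wedge\beta))$; (4) $(\alpha\wedge\beta)\to\alpha$; (5) $(\alpha\wedge\beta)\to\beta$; (6) $\alpha\to(\alpha\vee\beta)$; (7) $\beta\to(\alpha\vee\beta)$; (8) $(\alpha\to\gamma)\to((\beta\to\gamma)\to((\alpha\vee\beta)\to\gamma))$; (9) $(\alpha\to\beta)\vee\alpha$; (Ip) $(\alpha\uparrow\beta)\to(\alpha\to(\beta\to\gamma))$; (Comm) $(\alpha\uparrow\beta)\to(\beta\uparrow\alpha)$. $\Gamma\vdash_{\mathbf{bI}}\varphi$ means that there is a finite derivation of $\varphi$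 from premises in $\Gamma$. A non-deterministic matrix (Nmatrix) over a signature $\Sigma$ is a pair $\mathcal M=(\mathcal A,D)$ where $\mathcal A$ is a $\Sigma$-multialgebra with universe $A$ (each $n$-ary connective $\sigma$ is interpreted as a function $\sigma_{\mathcal A}:A^n\to\wp(A)\setminus\{\emptyset\}$) and $D$ is a proper nonempty subset of $A$. A valuation over $\mathcal M$ is a map $\nu:\mathbf F(\Sigma,\mathcal V)\to A$ with $\nu(\sigma(\varphi_1,\dots,\varphi_n))\in\sigma_{\mathcal A}(\nu(\varphi_1),\dots,\nu(\varphi_n))$ for all connectives $\sigma$ and formulas $\varphi_i$. $\Gamma\vDash_{\mathcal M}\varphi$ means: for every valuation $\nu$ over $\mathcal M$, if $\nu(\gamma)\in D$ for all $\gamma\in\Gamma$ then $\nu(\varphi)\in D$. *)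

theory Defs
  imports Main "HOL-Library.Countable_Set"
begin

datatype conn = Disj | Conj | Impl | Incomp

datatype 'v form = Var 'v | App conn "'v form" "'v form"

abbreviation disj_form :: "'v form \<Rightarrow> 'v form \<Rightarrow> 'v form"  (infixr "\<^bold>\<or>" 53)
  where "\<alpha> \<^bold>\<or> \<beta> \<equiv> App Disj \<alpha> \<beta>"

abbreviation conj_form :: "'v form \<Rightarrow> 'v form \<Rightarrow> 'v form"  (infixr "\<^bold>\<and>" 54)
  where "\<alpha> \<^bold>\<and> \<beta> \<equiv> App Conj \<alpha> \<beta>"

abbreviation impl_form :: "'v form \<Rightarrow> 'v form \<Rightarrow> 'v form"  (infixr "\<^bold>\<rightarrow>" 52)
  where "\<alpha> \<^bold>\<rightarrow> \<beta> \<equiv> App Impl \<alpha> \<beta>"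

abbreviation incomp_form :: "'v form \<Rightarrow> 'v form \<Rightarrow> 'v form"  (infixr "\<^bold>\<up>" 55)
  where "\<alpha> \<^bold>\<up> \<beta> \<equiv> App Incomp \<alpha> \<beta>"

inductive bI_axiom :: "'v form \<Rightarrow> bool" where
  Ax1: "bI_axiom (\<alpha> \<^bold>\<rightarrow> (\<beta> \<^bold>\<rightarrow> \<alpha>))"
| Ax2: "bI_axiom ((\<alpha> \<^bold>\<rightarrow> (\<beta> \<^bold>\<rightarrow> \<gamma>)) \<^bold>\<rightarrow> ((\<alpha> \<^bold>\<rightarrow> \<beta>) \<^bold>\<rightarrow> (\<alpha> \<^bold>\<rightarrow> \<gamma>)))"
| Ax3: "bI_axiom (\<alpha> \<^bold>\<rightarrow> (\<beta> \<^bold>\<rightarrow> (\<alpha> \<^bold>\<and> \<beta>)))"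
| Ax4: "bI_axiom ((\<alpha> \<^bold>\<and> \<beta>) \<^bold>\<rightarrow> \<alpha>)"
| Ax5: "bI_axiom ((\<alpha> \<^bold>\<and> \<beta>) \<^bold>\<rightarrow> \<beta>)"
| Ax6: "bI_axiom (\<alpha> \<^bold>\<rightarrow> (\<alpha> \<^bold>\<or> \<beta>))"
| Ax7: "bI_axiom (\<beta> \<^bold>\<rightarrow> (\<alpha> \<^bold>\<or> \<beta>))"
| Ax8: "bI_axiom ((\<alpha> \<^bold>\<rightarrow> \<gamma>) \<^bold>\<rightarrow> ((\<beta> \<^bold>\<rightarrow> \<gamma>) \<^bold>\<rightarrow> ((\<alpha> \<^bold>\<or> \<beta>) \<^bold>\<rightarrow> \<gamma>)))"
| Ax9: "bI_axiom ((\<alpha> \<^bold>\<rightarrow> \<beta>) \<^bold>\<or> \<alpha>)"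
| Ip: "bI_axiom ((\<alpha> \<^bold>\<up> \<beta>) \<^bold>\<rightarrow> (\<alpha> \<^bold>\<rightarrow> (\<beta> \<^bold>\<rightarrow> \<gamma>)))"
| Comm: "bI_axiom ((\<alpha> \<^bold>\<up> \<beta>) \<^bold>\<rightarrow> (\<beta> \<^bold>\<up> \<alpha>))"

inductive bI_derives :: "'v form set \<Rightarrow> 'v form \<Rightarrow> bool"  (infix "\<turnstile>\<^sub>b\<^sub>I" 50)
  for \<Gamma> :: "'v form set" where
  premise: "\<phi> \<in> \<Gamma> \<Longrightarrow> \<Gamma> \<turnstile>\<^sub>b\<^sub>I \<phi>"
| ax: "bI_axiom \<phi> \<Longrightarrow> \<Gamma> \<turnstile>\<^sub>b\<^sub>I \<phi>"
| mp: "\<Gamma> \<turnstile>\<^sub>b\<^sub>I \<phi> \<Longrightarrow> \<Gamma> \<turnstile>\<^sub>b\<^sub>I (\<phi> \<^bold>\<rightarrow> \<psi>) \<Longrightarrow> \<Gamma> \<turnstile>\<^sub>b\<^sub>I \<psi>"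

record 'a nmatrix =
  universe :: "'a set"
  interp :: "conn \<Rightarrow> 'a \<Rightarrow> 'a \<Rightarrow> 'a set"
  designated :: "'a set"

(* interp is a total HOL function; only its values on the universe are constrained and used. *)
definition is_nmatrix :: "'a nmatrix \<Rightarrow> bool" where
  "is_nmatrix M \<longleftrightarrow>
     (\<forall>c. \<forall>x\<in>universe M. \<forall>y\<in>universe M.
        interp M c x y \<noteq> {} \<and> interp M c x y \<subseteq> universe M) \<and>
     designated M \<noteq> {} \<and> designated M \<subset> universe M"

definition valuation :: "'a nmatrix \<Rightarrow> ('v form \<Rightarrow> 'a) \<Rightarrow> bool" where
  "valuation M \<nu> \<longleftrightarrow>
     (\<forall>\<phi>. \<nu> \<phi> \<in> universe M) \<and>
     (\<forall>c \<phi> \<psi>. \<nu> (App c \<phi> \<psi>) \<in> interp M c (\<nu> \<phi>) (\<nu> \<psi>))"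

definition nm_entails :: "'a nmatrix \<Rightarrow> 'v form set \<Rightarrow> 'v form \<Rightarrow> bool" where
  "nm_entails M \<Gamma> \<phi> \<longleftrightarrow>
     (\<forall>\<nu>. valuation M \<nu> \<longrightarrow> (\<forall>\<gamma>\<in>\<Gamma>. \<nu> \<gamma> \<in> designated M) \<longrightarrow> \<nu> \<phi> \<in> designated M)"

end

theory Submission
  imports Defs
begin

text \<open>
  Semantically, the axioms other than (Comm) only say how the truth value of a compound formula
  depends on those of its immediate subformulas; (Comm) instead ties together two
  different compounds, \<open>\<alpha> \<^bold>\<up> \<beta>\<close> and \<open>\<beta> \<^bold>\<up> \<alpha>\<close>.  An Nmatrix cannot see this tie when \<open>\<alpha>\<close> and \<open>\<beta>\<close> share a
  truth value \<open>a\<close>: both formulas then draw independently from the one set \<open>a \<up> a\<close>.  A matrix that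
  validates (Comm) must therefore have \<open>a \<up> a\<close> entirely designated or entirely undesignated for
  every \<open>a\<close> (lemma \<open>incomp_diagonal_homogeneous\<close>).

  On the other hand, the logic cannot prevent distinct variables from being pairwise incompatible
  while no variable is incompatible with itself.  This is witnessed by the classical bivaluation
  that makes all variables false, because (Ip) then allows any two variables to be incompatible or not (lemma
  \<open>distinct_vars_incompatible_consistent\<close>).  A matrix complete for the logic must have a valuation
  of this kind.  If the universe is finite, infinitely many variables cannot all receive different
  values; two variables \<open>x \<noteq> y\<close> with common value \<open>a\<close> put the designated value of \<open>x \<^bold>\<up> y\<close>
  and the undesignated value of \<open>x \<^bold>\<up> x\<close> into the same set \<open>a \<up> a\<close>, a contradiction.
\<close>

definition bivaluation :: "('v form \<Rightarrow> bool) \<Rightarrow> bool" where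
  "bivaluation v \<longleftrightarrow>
     (\<forall>\<alpha> \<beta>. (v (\<alpha> \<^bold>\<or> \<beta>) \<longleftrightarrow> v \<alpha> \<or> v \<beta>) \<and>
            (v (\<alpha> \<^bold>\<and> \<beta>) \<longleftrightarrow> v \<alpha> \<and> v \<beta>) \<and>
            (v (\<alpha> \<^bold>\<rightarrow> \<beta>) \<longleftrightarrow> (v \<alpha> \<longrightarrow> v \<beta>)) \<and>
            (v (\<alpha> \<^bold>\<up> \<beta>) \<longrightarrow> \<not> (v \<alpha> \<and> v \<beta>)) \<and>
            (v (\<alpha> \<^bold>\<up> \<beta>) \<longrightarrow> v (\<beta> \<^bold>\<up> \<alpha>)))"

lemma bI_sound_bivaluation:
  assumes "\<Gamma> \<turnstile>\<^sub>b\<^sub>I \<phi>" and v: "bivaluation v" and "\<forall>\<gamma>\<in>\<Gamma>. v \<gamma>"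
  shows "v \<phi>"
proof -
  have classical: "v (\<alpha> \<^bold>\<or> \<beta>) \<longleftrightarrow> v \<alpha> \<or> v \<beta>" "v (\<alpha> \<^bold>\<and> \<beta>) \<longleftrightarrow> v \<alpha> \<and> v \<beta>"
    "v (\<alpha> \<^bold>\<rightarrow> \<beta>) \<longleftrightarrow> (v \<alpha> \<longrightarrow> v \<beta>)" for \<alpha> \<beta>
    using v unfolding bivaluation_def by blast+
  have incomp: "v (\<alpha> \<^bold>\<up> \<beta>) \<Longrightarrow> \<not> (v \<alpha> \<and> v \<beta>)"
    and comm: "v (\<alpha> \<^bold>\<up> \<beta>) \<Longrightarrow> v (\<beta> \<^bold>\<up> \<alpha>)" for \<alpha> \<beta>
    using v unfolding bivaluation_def by blast+
  from assms(1) show ?thesis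
  proof induction
    case (premise \<phi>)
    then show ?case using assms(3) by blast
  next
    case (ax \<phi>)
    then show ?case
    proof cases
      case (Ip \<alpha> \<beta> \<gamma>)
      then show ?thesis using incomp by (simp add: classical)
    next
      case (Comm \<alpha> \<beta>)
      then show ?thesis using comm[of \<alpha> \<beta>] by (simp add: classical)
    qed (simp_all add: classical)
  next
    case (mp \<phi> \<psi>)
    then show ?case by (simp add: classical)
  qed
qed

primrec distinct_vars_bival :: "'v form \<Rightarrow> bool" where
  "distinct_vars_bival (Var x) = False"
| "distinct_vars_bival (App c \<alpha> \<beta>) =
     (case c of
        Disj \<Rightarrow> distinct_vars_bival \<alpha> \<or> distinct_vars_bival \<beta>
      | Conj \<Rightarrow> distinct_vars_bival \<alpha> \<and> distinct_vars_bival \<beta>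
      | Impl \<Rightarrow> distinct_vars_bival \<alpha> \<longrightarrow> distinct_vars_bival \<beta>
      | Incomp \<Rightarrow> (\<exists>x y. \<alpha> = Var x \<and> \<beta> = Var y \<and> x \<noteq> y))"

lemma bivaluation_distinct_vars_bival: "bivaluation distinct_vars_bival"
  unfolding bivaluation_def by auto

text \<open>
  Entailment has a single conclusion, so ``no variable is incompatible with itself'' is
  expressed by premises \<open>(x \<^bold>\<up> x) \<^bold>\<rightarrow> Var z\<close> together with the underivability of
  \<open>Var z\<close>: by Modus Ponens, a valuation that designates these premises but not \<open>Var z\<close>
  cannot designate any \<open>x \<^bold>\<up> x\<close>.
\<close>

lemma distinct_vars_incompatible_consistent:
  "\<not> {Var x \<^bold>\<up> Var y | x y. x \<noteq> y} \<union> {(Var x \<^bold>\<up> Var x) \<^bold>\<rightarrow> Var z | x. True}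
     \<turnstile>\<^sub>b\<^sub>I Var z"
proof
  assume "{Var x \<^bold>\<up> Var y | x y. x \<noteq> y} \<union> {(Var x \<^bold>\<up> Var x) \<^bold>\<rightarrow> Var z | x. True}
     \<turnstile>\<^sub>b\<^sub>I Var z"
  then have "distinct_vars_bival (Var z)"
    by (rule bI_sound_bivaluation[OF _ bivaluation_distinct_vars_bival]) auto
  then show False by simp
qed

primrec choice_extension ::
  "('v \<Rightarrow> 'a) \<Rightarrow> (conn \<Rightarrow> 'v form \<Rightarrow> 'v form \<Rightarrow> 'a \<Rightarrow> 'a \<Rightarrow> 'a) \<Rightarrow> 'v form \<Rightarrow> 'a" where
  "choice_extension g ch (Var x) = g x"
| "choice_extension g ch (App c \<alpha> \<beta>) =
     ch c \<alpha> \<beta> (choice_extension g ch \<alpha>) (choice_extension g ch \<beta>)"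

text \<open>
  Non-deterministic choices at different compound formulas are independent: any choice function
  that picks legal values extends every assignment of the variables to a valuation.
\<close>

lemma valuation_choice_extension:
  assumes M: "is_nmatrix M"
    and g: "\<And>x. g x \<in> universe M"
    and ch: "\<And>c \<alpha> \<beta> a b. a \<in> universe M \<Longrightarrow> b \<in> universe M \<Longrightarrow> ch c \<alpha> \<beta> a b \<in> interp M c a b"
  shows "valuation M (choice_extension g ch)"
proof -
  have in_univ: "choice_extension g ch \<phi> \<in> universe M" for \<phi>
  proof (induction \<phi>)
    case (Var x)
    then show ?case by (simp add: g)
  next
    case (App c \<alpha> \<beta>)
    then show ?case using ch[OF App] M unfolding is_nmatrix_def by fastforce
  qed
  then show ?thesis by (simp add: valuation_def ch)
qed

text \<open>
  With two variables of value \<open>a\<close>, the formulas \<open>Var x \<^bold>\<up> Var y\<close> and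
  \<open>Var y \<^bold>\<up> Var x\<close> may be given any two members of \<open>a \<up> a\<close>, whereas (Comm) makes one
  designated as soon as the other is.
\<close>

lemma incomp_diagonal_homogeneous:
  fixes M :: "'a nmatrix" and x y :: 'v
  assumes M: "is_nmatrix M"
    and sound: "\<And>(\<Gamma> :: 'v form set) \<phi>. \<Gamma> \<turnstile>\<^sub>b\<^sub>I \<phi> \<Longrightarrow> nm_entails M \<Gamma> \<phi>"
    and "x \<noteq> y" and a: "a \<in> universe M"
    and d: "d \<in> interp M Incomp a a" "d \<in> designated M"
    and u: "u \<in> interp M Incomp a a"
  shows "u \<in> designated M"
proof -
  define ch where "ch c (\<alpha> :: 'v form) (\<beta> :: 'v form) r s =
    (if c = Incomp \<and> r = a \<and> s = a then (if \<alpha> = Var x then d else u)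
     else (SOME t. t \<in> interp M c r s))" for c \<alpha> \<beta> r s
  define \<nu> where "\<nu> = choice_extension (\<lambda>_. a) ch"
  have "ch c \<alpha> \<beta> r s \<in> interp M c r s"
    if "r \<in> universe M" "s \<in> universe M" for c \<alpha> \<beta> r s
  proof -
    have "interp M c r s \<noteq> {}" using M that by (simp add: is_nmatrix_def)
    then show ?thesis using d u by (auto simp: ch_def some_in_eq)
  qed
  then have val: "valuation M \<nu>"
    unfolding \<nu>_def by (rule valuation_choice_extension[OF M a])
  have xy: "\<nu> (Var x \<^bold>\<up> Var y) = d" and yx: "\<nu> (Var y \<^bold>\<up> Var x) = u"
    using \<open>x \<noteq> y\<close> by (simp_all add: \<nu>_def ch_def)
  have "{Var x \<^bold>\<up> Var y} \<turnstile>\<^sub>b\<^sub>I Var y \<^bold>\<up> Var x"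
    by (rule bI_derives.mp[OF bI_derives.premise bI_derives.ax[OF bI_axiom.Comm]]) simp
  from sound[OF this] val xy d(2) have "\<nu> (Var y \<^bold>\<up> Var x) \<in> designated M"
    unfolding nm_entails_def by blast
  then show ?thesis by (simp add: yx)
qed

theorem theorem14:
  assumes "countable (UNIV :: 'v set)" and "infinite (UNIV :: 'v set)"
  shows "\<not> (\<exists>M :: 'a nmatrix.
           is_nmatrix M \<and> finite (universe M) \<and>
           (\<forall>(\<Gamma> :: 'v form set) (\<phi> :: 'v form). \<Gamma> \<turnstile>\<^sub>b\<^sub>I \<phi> \<longleftrightarrow> nm_entails M \<Gamma> \<phi>))"
proof
  assume "\<exists>M :: 'a nmatrix. is_nmatrix M \<and> finite (universe M) \<and>
           (\<forall>(\<Gamma> :: 'v form set) (\<phi> :: 'v form). \<Gamma> \<turnstile>\<^sub>b\<^sub>I \<phi> \<longleftrightarrow> nm_entails M \<Gamma> \<phi>)"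
  then obtain M :: "'a nmatrix" where M: "is_nmatrix M" and fin: "finite (universe M)"
    and char: "\<And>(\<Gamma> :: 'v form set) \<phi>. \<Gamma> \<turnstile>\<^sub>b\<^sub>I \<phi> \<longleftrightarrow> nm_entails M \<Gamma> \<phi>"
    by blast
  obtain z :: 'v where True by blast
  let ?\<Gamma> = "{Var x \<^bold>\<up> Var y | x y. x \<noteq> y} \<union> {(Var x \<^bold>\<up> Var x) \<^bold>\<rightarrow> Var z | x. True}
    :: 'v form set"
  have "\<not> nm_entails M ?\<Gamma> (Var z)"
    unfolding char[symmetric] by (rule distinct_vars_incompatible_consistent)
  then obtain \<nu> where val: "valuation M \<nu>"
    and des: "\<And>\<gamma>. \<gamma> \<in> ?\<Gamma> \<Longrightarrow> \<nu> \<gamma> \<in> designated M" and z: "\<nu> (Var z) \<notin> designated M"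
    unfolding nm_entails_def by blast
  have univ: "\<nu> \<phi> \<in> universe M" for \<phi>
    using val by (simp add: valuation_def)
  have "finite (range (\<lambda>x. \<nu> (Var x)))"
    by (rule finite_subset[OF _ fin]) (use univ in blast)
  then have "\<not> inj (\<lambda>x. \<nu> (Var x))"
    using assms(2) finite_imageD[of _ UNIV] by metis
  then obtain x y where "x \<noteq> y" and eq: "\<nu> (Var x) = \<nu> (Var y)"
    by (auto simp: inj_def)
  have "\<nu> (Var x \<^bold>\<up> Var x) \<in> interp M Incomp (\<nu> (Var x)) (\<nu> (Var x))"
    using val by (simp add: valuation_def)
  moreover have "\<nu> (Var x \<^bold>\<up> Var y) \<in> interp M Incomp (\<nu> (Var x)) (\<nu> (Var x))"
    using val eq unfolding valuation_def by metis
  moreover have "\<nu> (Var x \<^bold>\<up> Var y) \<in> designated M"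
    using \<open>x \<noteq> y\<close> by (intro des) blast
  ultimately have xx: "\<nu> (Var x \<^bold>\<up> Var x) \<in> designated M"
    using incomp_diagonal_homogeneous[OF M iffD1[OF char] \<open>x \<noteq> y\<close> univ] by blast
  have "{Var x \<^bold>\<up> Var x, (Var x \<^bold>\<up> Var x) \<^bold>\<rightarrow> Var z} \<turnstile>\<^sub>b\<^sub>I Var z"
    by (rule bI_derives.mp[OF bI_derives.premise bI_derives.premise]) auto
  then have "nm_entails M {Var x \<^bold>\<up> Var x, (Var x \<^bold>\<up> Var x) \<^bold>\<rightarrow> Var z} (Var z)"
    unfolding char .
  moreover have "\<nu> ((Var x \<^bold>\<up> Var x) \<^bold>\<rightarrow> Var z) \<in> designated M"
    by (intro des) blast
  ultimately have "\<nu> (Var z) \<in> designated M"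
    using val xx unfolding nm_entails_def by blast
  with z show False ..
qed

end
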